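(* Let $\{(X_i,a_i)\}_{i\ge0}$ be a controlled Markov chain with finite state space $\mathcal S$ and finite action space $\mathcal A$. Suppose that for all state-action pairs $(s,l)\in\mathcal S\times\mathcal A$ there exist $0<\alpha<1$ and a deterministic sequence $(T_i)_{i\ge1}$ with $T_i=O(i^\alpha)$ such that for all $i\ge1$, $$\mathbb E\Big[\tau^{(i)}_{s,l}\;\Big|\;\mathcal F_{\sum_{p=1}^{i-1}\tau^{(p)}_{s,l}}\Big]\le T_i\quad\text{almost surely}.$$ Then for all $(s,l)$, as $n\to\infty$, $$\mathbb E\big[N_s^{(l)}(n)\big]=\Omega\big(n^{\frac{1}{1+\alpha}}\big).$$
   Context: Controlled Markov chain (CMC): let $\mathcal F_j=\sigma(X_0,a_0,\dots,X_j,a_j)$. A CMC is a process $\{(X_i,a_i)\}_{i\ge0}$ with values in $\mathcal S\times\mathcal A$ such that for all times $i$ and all histories $(s_0,l_0,\dots,s_i,l_i)$ of positive probability, $\mathbb P(X_{i+1}=t\mid X_0=s_0,a_0=l_0,\dots,X_i=s_i,a_i=l_i)=\mathbb P(X_{i+1}=t\mid X_i=s_i,a_i=l_i)=M^{(l_i)}_{s_i,t}$, with $M^{(l)}_{s,t}$ not depending on $i$. The law of $a_i$ given $(X_0,a_0,\dots,X_{i-1},a_{i-1},X_i)$ may be history-dependent and time-inhomogeneous. $N_s^{(l)}(n)=\sum_{i=0}^{n-1}\mathbb 1[X_i=s,a_i=l]$ is the number of visits to $(s,l)$. Return times: $\tau^{(1)}_{s,l}=\min\{i>0:X_i=s,a_i=l\}$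 and, for $i\ge2$, $\tau^{(i)}_{s,l}=\min\{m>0: X_{\sum_{j=1}^{i-1}\tau^{(j)}_{s,l}+m}=s,\ a_{\sum_{j=1}^{i-1}\tau^{(j)}_{s,l}+m}=l\}$. $\mathcal F_{\sum_{p=1}^{i-1}\tau^{(p)}_{s,l}}$ is the $\sigma$-algebra of the corresponding stopping time. $f(n)=\Omega(h(n))$ means $f(n)\ge c\,h(n)$ for some constant $c>0$ and all sufficiently large $n$. *)

theory Defs
  imports "HOL-Probability.Probability" "HOL-Library.Landau_Symbols"
begin

locale controlled_markov_chain = prob_space M
  for M :: "'w measure" +
  fixes X :: "nat \<Rightarrow> 'w \<Rightarrow> 's::finite"
    and a :: "nat \<Rightarrow> 'w \<Rightarrow> 'a::finite"
    and P :: "'a \<Rightarrow> 's \<Rightarrow> 's \<Rightarrow> real"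
  assumes measurable_X: "X i \<in> measurable M (count_space UNIV)"
    and measurable_a: "a i \<in> measurable M (count_space UNIV)"
    and history_transition:
      "\<P>(\<omega> in M. \<forall>j\<le>i. X j \<omega> = s j \<and> a j \<omega> = l j) > 0 \<Longrightarrow>
       \<P>(\<omega> in M. X (Suc i) \<omega> = t \<bar> \<forall>j\<le>i. X j \<omega> = s j \<and> a j \<omega> = l j)
         = \<P>(\<omega> in M. X (Suc i) \<omega> = t \<bar> X i \<omega> = s i \<and> a i \<omega> = l i)"
    and transition:
      "\<P>(\<omega> in M. \<forall>j\<le>i. X j \<omega> = s j \<and> a j \<omega> = l j) > 0 \<Longrightarrow>
       \<P>(\<omega> in M. X (Suc i) \<omega> = t \<bar> X i \<omega> = s i \<and> a i \<omega> = l i) = P (l i) (s i) t"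

definition visits ::
  "(nat \<Rightarrow> 'w \<Rightarrow> 's) \<Rightarrow> (nat \<Rightarrow> 'w \<Rightarrow> 'a) \<Rightarrow> 's \<Rightarrow> 'a \<Rightarrow> nat \<Rightarrow> 'w \<Rightarrow> real" where
  "visits X a s l n \<omega> = (\<Sum>i<n. of_bool (X i \<omega> = s \<and> a i \<omega> = l))"

text \<open>
  The \<open>i\<close>-th return time, for \<open>i \<ge> 1\<close>, counted from the preceding return
  (from time \<open>0\<close> if \<open>i = 1\<close>, where the sum is empty). It is \<open>\<infinity>\<close>, the infimum of the
  empty set, if there is no further return or if an earlier return time is already infinite.
\<close>

function return_time ::
  "(nat \<Rightarrow> 'w \<Rightarrow> 's) \<Rightarrow> (nat \<Rightarrow> 'w \<Rightarrow> 'a) \<Rightarrow> 's \<Rightarrow> 'a \<Rightarrow> nat \<Rightarrow> 'w \<Rightarrow> enat" where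
  "return_time X a s l i \<omega> =
     Inf {enat m | m k. m > 0 \<and> (\<Sum>j=1..<i. return_time X a s l j \<omega>) = enat k
                        \<and> X (k + m) \<omega> = s \<and> a (k + m) \<omega> = l}"
  by auto
termination
  by (relation "Wellfounded.measure (\<lambda>(X, a, s, l, i, \<omega>). i)") auto

declare return_time.simps [simp del]

text \<open>
  The natural filtration of the process \<open>(X, a)\<close>. Time \<open>\<infinity>\<close> (the whole history) is included
  because sums of return times are stopping times that may be infinite.
\<close>

definition history ::
  "'w measure \<Rightarrow> (nat \<Rightarrow> 'w \<Rightarrow> 's) \<Rightarrow> (nat \<Rightarrow> 'w \<Rightarrow> 'a) \<Rightarrow> enat \<Rightarrow> 'w measure" where
  "history M X a t = sigma (space M)
     ({X i -` B \<inter> space M | i B. enat i \<le> t} \<union> {a i -` B \<inter> space M | i B. enat i \<le> t})"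

abbreviation return_sum ::
  "(nat \<Rightarrow> 'w \<Rightarrow> 's) \<Rightarrow> (nat \<Rightarrow> 'w \<Rightarrow> 'a) \<Rightarrow> 's \<Rightarrow> 'a \<Rightarrow> nat \<Rightarrow> 'w \<Rightarrow> enat" where
  "return_sum X a s l i \<omega> \<equiv> \<Sum>p=1..<i. return_time X a s l p \<omega>"

abbreviation return_history ::
  "'w measure \<Rightarrow> (nat \<Rightarrow> 'w \<Rightarrow> 's) \<Rightarrow> (nat \<Rightarrow> 'w \<Rightarrow> 'a) \<Rightarrow> 's \<Rightarrow> 'a \<Rightarrow> nat \<Rightarrow> 'w measure" where
  "return_history M X a s l i \<equiv>
     filtration.pre_sigma (space M) (history M X a) (return_sum X a s l i)"

text \<open>
  \<^const>\<open>nn_cond_exp\<close> is a conditional expectation only for measurable functions and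
  sub-\<open>\<sigma>\<close>-algebras, and \<^const>\<open>filtration.pre_sigma\<close> is the intended \<open>\<sigma>\<close>-algebra only for
  stopping times of a filtration. The following facts establish these side conditions.
\<close>

lemma space_history [simp]: "space (history M X a t) = space M"
  unfolding history_def by (rule space_measure_of) auto

lemma sets_history:
  "sets (history M X a t) = sigma_sets (space M)
     ({X i -` B \<inter> space M | i B. enat i \<le> t} \<union> {a i -` B \<inter> space M | i B. enat i \<le> t})"
  unfolding history_def by (rule sets_measure_of) auto

lemma filtration_history: "filtration (space M) (history M X a)"
proof
  fix i j :: enat
  assume "i \<le> j"
  then have "enat k \<le> j" if "enat k \<le> i" for k
    using that by (rule order_trans[rotated])
  then show "sets (history M X a i) \<le> sets (history M X a j)"
    unfolding sets_history by (intro sigma_sets_mono' Un_mono) blast+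
qed simp

lemma return_time_le_iff:
  "return_time X a s l i \<omega> \<le> enat n \<longleftrightarrow>
    (\<exists>m\<in>{0<..n}. \<exists>k. return_sum X a s l i \<omega> = enat k \<and> X (k + m) \<omega> = s \<and> a (k + m) \<omega> = l)"
    (is "?L \<longleftrightarrow> ?R")
proof -
  let ?S = "{enat m | m k. m > 0 \<and> return_sum X a s l i \<omega> = enat k
                        \<and> X (k + m) \<omega> = s \<and> a (k + m) \<omega> = l}"
  have eq: "return_time X a s l i \<omega> = Inf ?S"
    by (subst return_time.simps) rule
  show ?thesis
  proof
    assume ?L
    then have le: "Inf ?S \<le> enat n"
      unfolding eq .
    then have "?S \<noteq> {}"
      unfolding Inf_enat_def by force
    then have "Inf ?S \<in> ?S"
      unfolding Inf_enat_def by (metis (mono_tags, lifting) LeastI ex_in_conv)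
    with le show ?R by auto
  next
    assume ?R
    then obtain m k where "0 < m" "m \<le> n" "return_sum X a s l i \<omega> = enat k"
      "X (k + m) \<omega> = s" "a (k + m) \<omega> = l" by auto
    then have "Inf ?S \<le> enat m"
      by (intro Inf_lower) auto
    also have "\<dots> \<le> enat n" using \<open>m \<le> n\<close> by simp
    finally show ?L unfolding eq .
  qed
qed

lemma return_sum_Suc_le_iff:
  assumes "i \<ge> 1"
  shows "return_sum X a s l (Suc i) \<omega> \<le> enat n \<longleftrightarrow>
    (\<exists>k\<in>{..n}. return_sum X a s l i \<omega> = enat k \<and>
      (\<exists>m\<in>{k<..n}. X m \<omega> = s \<and> a m \<omega> = l))"  (is "?L \<longleftrightarrow> ?R")
proof (cases "return_sum X a s l i \<omega>")
  case (enat k)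
  have sum: "return_sum X a s l (Suc i) \<omega> = enat k + return_time X a s l i \<omega>"
    using assms enat by simp
  have "?L \<longleftrightarrow> k \<le> n \<and> return_time X a s l i \<omega> \<le> enat (n - k)"
    unfolding sum by (cases "return_time X a s l i \<omega>") auto
  also have "\<dots> \<longleftrightarrow> k \<le> n \<and> (\<exists>m\<in>{0<..n - k}. X (k + m) \<omega> = s \<and> a (k + m) \<omega> = l)"
    unfolding return_time_le_iff enat by simp
  also have "\<dots> \<longleftrightarrow> k \<le> n \<and> (\<exists>m\<in>{k<..n}. X m \<omega> = s \<and> a m \<omega> = l)"
  proof (intro conj_cong refl iffI)
    assume "\<exists>m\<in>{0<..n - k}. X (k + m) \<omega> = s \<and> a (k + m) \<omega> = l"
    then obtain m where "0 < m" "m \<le> n - k" "X (k + m) \<omega> = s \<and> a (k + m) \<omega> = l" by auto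
    then show "\<exists>m\<in>{k<..n}. X m \<omega> = s \<and> a m \<omega> = l"
      by (intro bexI[of _ "k + m"]) auto
  next
    assume "\<exists>m\<in>{k<..n}. X m \<omega> = s \<and> a m \<omega> = l"
    then obtain m where "k < m" "m \<le> n" "X m \<omega> = s \<and> a m \<omega> = l" by auto
    then show "\<exists>m\<in>{0<..n - k}. X (k + m) \<omega> = s \<and> a (k + m) \<omega> = l"
      by (intro bexI[of _ "m - k"]) auto
  qed
  also have "\<dots> \<longleftrightarrow> ?R"
    unfolding enat by auto
  finally show ?thesis .
next
  case infinity
  then show ?thesis using assms by simp
qed

context controlled_markov_chain
begin

lemma subalgebra_history: "subalgebra M (history M X a t)"
  unfolding subalgebra_def sets_history
  using measurable_X measurable_a
  by (auto intro!: sets.sigma_sets_subset measurable_sets)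

lemma visit_in_history:
  assumes "i \<le> n"
  shows "Measurable.pred (history M X a (enat n)) (\<lambda>\<omega>. X i \<omega> = s \<and> a i \<omega> = l)"
proof -
  have "X i -` {s} \<inter> space M \<in> sets (history M X a (enat n))"
       "a i -` {l} \<inter> space M \<in> sets (history M X a (enat n))"
    unfolding sets_history using assms by (auto intro!: sigma_sets.Basic)
  then have "(X i -` {s} \<inter> space M) \<inter> (a i -` {l} \<inter> space M) \<in> sets (history M X a (enat n))"
    by (rule sets.Int)
  then show ?thesis
    unfolding Measurable.pred_def by (rule back_subst) auto
qed

lemma stopping_time_return_sum: "stopping_time (history M X a) (return_sum X a s l i)"
proof (induction i)
  case 0
  then show ?case by (simp add: stopping_time_const)
next
  case (Suc i)
  interpret H: filtration "space M" "history M X a"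
    by (rule filtration_history)
  show ?case
  proof (cases "i \<ge> 1")
    case False
    then show ?thesis by (simp add: stopping_time_const)
  next
    case True
    show ?thesis
    proof
      fix t
      show "Measurable.pred (history M X a t) (\<lambda>\<omega>. return_sum X a s l (Suc i) \<omega> \<le> t)"
      proof (cases t)
        case (enat n)
        define V where "V m \<omega> \<longleftrightarrow> X m \<omega> = s \<and> a m \<omega> = l" for m \<omega>
        have sum: "Measurable.pred (history M X a (enat n))
            (\<lambda>\<omega>. return_sum X a s l i \<omega> = enat k)" if "k \<le> n" for k
          using H.stopping_time_eq_const[OF Suc.IH, of "enat k"] H.sets_F_mono[of "enat k" "enat n"] that
          by (auto simp: pred_def)
        have visit: "Measurable.pred (history M X a (enat n)) (V m)" if "m \<le> n" for m
          unfolding V_def using that by (rule visit_in_history)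
        have "Measurable.pred (history M X a (enat n))
            (\<lambda>\<omega>. \<exists>k\<in>{..n}. return_sum X a s l i \<omega> = enat k \<and> (\<exists>m\<in>{k<..n}. V m \<omega>))"
          by (intro pred_intros_finite pred_intros_logic sum visit) simp_all
        then show ?thesis
          unfolding enat return_sum_Suc_le_iff[OF True] V_def .
      qed simp
    qed
  qed
qed

lemma subalgebra_return_history: "subalgebra M (return_history M X a s l i)"
proof -
  interpret H: filtration "space M" "history M X a"
    by (rule filtration_history)
  have "A \<in> sets M" if "A \<in> sets (return_history M X a s l i)" for A
  proof -
    from H.sets_pre_sigmaD[OF stopping_time_return_sum that, of \<infinity>]
    show ?thesis
      using subalgebra_history[of \<infinity>] by (auto simp: subalgebra_def)
  qed
  then show ?thesis
    by (auto simp: subalgebra_def H.space_pre_sigma)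
qed

lemma measurable_return_time:
  "(\<lambda>\<omega>. ennreal_of_enat (return_time X a s l i \<omega>)) \<in> borel_measurable M"
proof -
  have sum [measurable]: "Measurable.pred M (\<lambda>\<omega>. return_sum X a s l i \<omega> = enat k)" for k
  proof -
    have "return_sum X a s l i \<in> borel_measurable M"
      using measurable_stopping_time[OF stopping_time_return_sum] subalgebra_history
      by (auto simp: subalgebra_def)
    then show ?thesis by (rule pred_eq_const1) simp
  qed
  have [measurable]: "Measurable.pred M (\<lambda>\<omega>. X m \<omega> = s \<and> a m \<omega> = l)" for m
    by (rule measurable_from_subalg[OF subalgebra_history visit_in_history[OF order_refl]])
  have "Measurable.pred M (\<lambda>\<omega>. return_time X a s l i \<omega> \<le> t)" for t
  proof (cases t)
    case (enat n)
    show ?thesis unfolding enat return_time_le_iff by measurable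
  qed simp
  then have "return_time X a s l i \<in> borel_measurable M"
    by (intro borel_measurableI_le) (simp add: pred_def)
  then have "return_time X a s l i \<in> measurable M (count_space UNIV)"
    unfolding measurable_count_space_eq_countable[OF countableI_type]
    by (auto intro: measurable_sets)
  then show ?thesis by (rule measurable_compose) simp
qed

end

end

theory Submission
  imports Defs "HOL-Real_Asymp.Real_Asymp"
begin

text \<open>
  Write \<open>S\<close> for the time of the \<open>k\<close>-th return and \<open>N\<close> for the number of visits before time \<open>n\<close>.
  Taking expectations in the hypothesis and summing gives \<open>E S \<le> C k\<^bsup>1+\<alpha>\<^esup>\<close>. Either \<open>S \<ge> n\<close> or
  \<open>N \<ge> k\<close>, so \<open>n k \<le> n N + k S\<close> pointwise, and choosing \<open>k\<close> of order \<open>n\<^bsup>1/(1+\<alpha>)\<^esup>\<close> such that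
  \<open>C k\<^bsup>1+\<alpha>\<^esup> \<le> n/2\<close> yields \<open>E N \<ge> k/2\<close>.
\<close>

text \<open>The Landau bound fails at finitely many indices at most. Since
  \<open>real i powr \<alpha>\<close> is at least 1 for i >= 1 and \<alpha> >= 0, adding the sum of
  those |f i| to the constant covers them as well.\<close>

lemma bigo_powr_uniform_bound:
  fixes f :: "nat \<Rightarrow> real"
  assumes "f \<in> O(\<lambda>i. real i powr \<alpha>)" and "\<alpha> \<ge> 0"
  obtains C where "C > 0" and "\<And>i. i \<ge> 1 \<Longrightarrow> f i \<le> C * real i powr \<alpha>"
proof -
  obtain c where "c > 0" and "eventually (\<lambda>i. norm (f i) \<le> c * norm (real i powr \<alpha>)) at_top"
    using assms(1) by (rule landau_o.bigE)
  then obtain m where m: "\<And>i. i \<ge> m \<Longrightarrow> \<bar>f i\<bar> \<le> c * real i powr \<alpha>"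
    by (auto simp: eventually_at_top_linorder)
  define C where "C = c + (\<Sum>i<m. \<bar>f i\<bar>)"
  have sum_nonneg: "0 \<le> (\<Sum>i<m. \<bar>f i\<bar>)"
    by (intro sum_nonneg) simp
  have "f i \<le> C * real i powr \<alpha>" if "i \<ge> 1" for i
  proof (cases "i < m")
    case True
    have "1 \<le> real i powr \<alpha>"
      using that assms(2) by (intro ge_one_powr_ge_zero) auto
    have "f i \<le> (\<Sum>i<m. \<bar>f i\<bar>)"
      using member_le_sum[of i "{..<m}" "\<lambda>i. \<bar>f i\<bar>"] True by simp
    also have "\<dots> \<le> C * 1"
      using \<open>c > 0\<close> by (simp add: C_def)
    also have "\<dots> \<le> C * real i powr \<alpha>"
      using \<open>1 \<le> real i powr \<alpha>\<close> \<open>c > 0\<close> sum_nonneg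
      by (intro mult_left_mono) (auto simp: C_def)
    finally show ?thesis .
  next
    case False
    then have "f i \<le> c * real i powr \<alpha>"
      using m[of i] by simp
    also have "\<dots> \<le> C * real i powr \<alpha>"
      using sum_nonneg by (intro mult_right_mono) (auto simp: C_def)
    finally show ?thesis .
  qed
  moreover have "C > 0"
    using \<open>c > 0\<close> sum_nonneg by (simp add: C_def add_pos_nonneg)
  ultimately show ?thesis
    using that by blast
qed

lemma visits_nonneg: "0 \<le> visits X a s l n \<omega>"
  unfolding visits_def by (intro sum_nonneg) simp

text \<open>Each return is a visit, and distinct returns happen at distinct times. Offsets:
  \<open>return_sum\<close> at \<open>Suc i\<close> is the time of the i-th return, and
  \<open>visits\<close> at \<open>Suc n\<close> counts times up to and including n. Equality may
  fail because a visit at time 0 is no return.\<close>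

lemma visits_ge_if_return_sum_le:
  "return_sum X a s l (Suc i) \<omega> \<le> enat n \<Longrightarrow> real i \<le> visits X a s l (Suc n) \<omega>"
proof (induction i arbitrary: n)
  case 0
  then show ?case by (simp add: visits_nonneg)
next
  case (Suc i)
  then obtain k m where km: "return_sum X a s l (Suc i) \<omega> = enat k" "k < m" "m \<le> n"
    and visit: "X m \<omega> = s" "a m \<omega> = l"
    using return_sum_Suc_le_iff[of "Suc i" X a s l \<omega> n] by (auto simp del: sum.op_ivl_Suc)
  \<comment> \<open>The induction hypothesis is used at the time k of the preceding return. Since k
    < m, the visit at m is not among those already counted.\<close>
  have "real i \<le> visits X a s l (Suc k) \<omega>"
    using km by (intro Suc.IH) simp
  also have "\<dots> \<le> visits X a s l m \<omega>"
    unfolding visits_def using km by (intro sum_mono2) auto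
  finally have "real (Suc i) \<le> visits X a s l (Suc m) \<omega>"
    using visit by (simp add: visits_def)
  also have "\<dots> \<le> visits X a s l (Suc n) \<omega>"
    unfolding visits_def using km by (intro sum_mono2) auto
  finally show ?case .
qed

text \<open>In each case one of the two summands alone dominates the left side. The inequality lives
  in \<open>ennreal\<close> because the return sum is infinite when the k-th return never occurs;
  that outcome falls under the second case.\<close>

lemma visits_return_sum_tradeoff:
  "ennreal n * ennreal k
     \<le> ennreal n * ennreal (visits X a s l n \<omega>)
       + ennreal k * ennreal_of_enat (return_sum X a s l (Suc k) \<omega>)"
proof (cases "return_sum X a s l (Suc k) \<omega> < enat n")
  case True
  \<comment> \<open>A return strictly before n happens by time m = n - 1, which matches the count
    over times below n.\<close>
  then obtain m where m: "n = Suc m" "return_sum X a s l (Suc k) \<omega> \<le> enat m"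
    by (cases n) (auto simp: zero_enat_def[symmetric] less_Suc_eq_le elim!: less_enatE)
  then have "real k \<le> visits X a s l n \<omega>"
    using visits_ge_if_return_sum_le[OF m(2)] by simp
  then show ?thesis
    by (intro add_increasing2 mult_left_mono ennreal_leI) auto
next
  case False
  then have "ennreal_of_enat (enat n) \<le> ennreal_of_enat (return_sum X a s l (Suc k) \<omega>)"
    by (subst ennreal_of_enat_le_iff) auto
  then have "ennreal n \<le> ennreal_of_enat (return_sum X a s l (Suc k) \<omega>)"
    by (simp add: ennreal_of_nat_eq_real_of_nat)
  then show ?thesis
    by (subst mult.commute) (intro add_increasing mult_left_mono, auto)
qed

context controlled_markov_chain
begin

lemma borel_measurable_visits: "visits X a s l n \<in> borel_measurable M"
proof -
  have [measurable]: "Measurable.pred M (\<lambda>\<omega>. X i \<omega> = s \<and> a i \<omega> = l)" for i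
    by (rule measurable_from_subalg[OF subalgebra_history visit_in_history[OF order_refl]])
  show ?thesis
    unfolding visits_def of_bool_def by measurable
qed

text \<open>The count lies between 0 and n, hence is integrable. This carries bounds obtained in
  \<open>ennreal\<close> over to the Bochner integral.\<close>

lemma nn_integral_visits:
  "(\<integral>\<^sup>+\<omega>. ennreal (visits X a s l n \<omega>) \<partial>M) = ennreal (\<integral>\<omega>. visits X a s l n \<omega> \<partial>M)"
proof (rule nn_integral_eq_integral)
  have "visits X a s l n \<omega> \<le> real n" for \<omega>
  proof -
    have "visits X a s l n \<omega> \<le> (\<Sum>i<n. 1)"
      unfolding visits_def by (intro sum_mono) simp
    then show ?thesis by simp
  qed
  then show "integrable M (visits X a s l n)"
    by (intro integrable_const_bound[of _ "real n"] borel_measurable_visits)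
       (simp add: visits_nonneg)
qed (simp add: visits_nonneg)

text \<open>Tower property: testing the conditional expectation against the constant 1 recovers the
  plain expectation, and a constant integrates to itself under a probability measure.\<close>

lemma nn_integral_return_time_le:
  assumes "AE \<omega> in M. nn_cond_exp M (return_history M X a s l i)
    (\<lambda>\<omega>. ennreal_of_enat (return_time X a s l i \<omega>)) \<omega> \<le> c"
  shows "(\<integral>\<^sup>+\<omega>. ennreal_of_enat (return_time X a s l i \<omega>) \<partial>M) \<le> c"
proof -
  interpret sub: finite_measure_subalgebra M "return_history M X a s l i"
    by unfold_locales (rule subalgebra_return_history)
  have "(\<integral>\<^sup>+\<omega>. ennreal_of_enat (return_time X a s l i \<omega>) \<partial>M)
      = (\<integral>\<^sup>+\<omega>. nn_cond_exp M (return_history M X a s l i)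
          (\<lambda>\<omega>. ennreal_of_enat (return_time X a s l i \<omega>)) \<omega> \<partial>M)"
    using sub.nn_cond_exp_intg[of "\<lambda>_. 1" "\<lambda>\<omega>. ennreal_of_enat (return_time X a s l i \<omega>)"]
    by (simp add: measurable_return_time)
  also have "\<dots> \<le> (\<integral>\<^sup>+\<omega>. c \<partial>M)"
    using assms by (rule nn_integral_mono_AE)
  also have "\<dots> = c"
    by (simp add: emeasure_space_1)
  finally show ?thesis .
qed

text \<open>As \<alpha> >= 0, each of the k summands is at most the last bound C k^\<alpha>.
  Compared with summing i^\<alpha> exactly, this costs only a constant factor.\<close>

lemma nn_integral_return_sum_le:
  assumes "\<And>i. i \<ge> 1 \<Longrightarrow>
    (\<integral>\<^sup>+\<omega>. ennreal_of_enat (return_time X a s l i \<omega>) \<partial>M) \<le> ennreal (C * real i powr \<alpha>)"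
    and "C \<ge> 0" and "\<alpha> \<ge> 0"
  shows "(\<integral>\<^sup>+\<omega>. ennreal_of_enat (return_sum X a s l (Suc k) \<omega>) \<partial>M)
    \<le> ennreal (C * real k powr (1 + \<alpha>))"
proof -
  have "(\<integral>\<^sup>+\<omega>. ennreal_of_enat (return_sum X a s l (Suc k) \<omega>) \<partial>M)
      = (\<Sum>i=1..<Suc k. \<integral>\<^sup>+\<omega>. ennreal_of_enat (return_time X a s l i \<omega>) \<partial>M)"
    unfolding sum_ennreal_of_enat[symmetric] by (intro nn_integral_sum measurable_return_time)
  also have "\<dots> \<le> (\<Sum>i=1..<Suc k. ennreal (C * real k powr \<alpha>))"
  proof (rule sum_mono)
    fix i assume i: "i \<in> {1..<Suc k}"
    have "C * real i powr \<alpha> \<le> C * real k powr \<alpha>"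
      using i assms(2,3) by (intro mult_left_mono powr_mono2) auto
    then show "(\<integral>\<^sup>+\<omega>. ennreal_of_enat (return_time X a s l i \<omega>) \<partial>M) \<le> ennreal (C * real k powr \<alpha>)"
      using assms(1)[of i] i by (auto intro: order_trans ennreal_leI)
  qed
  also have "\<dots> = ennreal (real k * (C * real k powr \<alpha>))"
    using assms(2) by (simp add: ennreal_of_nat_eq_real_of_nat ennreal_mult)
  also have "real k * (C * real k powr \<alpha>) = C * real k powr (1 + \<alpha>)"
    by (cases "k = 0") (simp_all add: powr_add)
  finally show ?thesis .
qed

text \<open>Integrating the pointwise tradeoff, the return sum accounts for at most half of n k, so
  n E N carries the other half; then divide by n.\<close>

lemma expected_visits_ge:
  assumes "(\<integral>\<^sup>+\<omega>. ennreal_of_enat (return_sum X a s l (Suc k) \<omega>) \<partial>M) \<le> ennreal (real n / 2)"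
    and "n > 0"
  shows "real k / 2 \<le> (\<integral>\<omega>. visits X a s l n \<omega> \<partial>M)"
proof -
  let ?N = "visits X a s l n"
  define S where "S \<omega> = ennreal_of_enat (return_sum X a s l (Suc k) \<omega>)" for \<omega>
  have [measurable]: "S \<in> borel_measurable M"
    unfolding S_def sum_ennreal_of_enat[symmetric] by (intro borel_measurable_sum measurable_return_time)
  note [measurable] = borel_measurable_visits
  have EN: "0 \<le> (\<integral>\<omega>. ?N \<omega> \<partial>M)"
    by (simp add: visits_nonneg)
  have "ennreal n * ennreal k = (\<integral>\<^sup>+\<omega>. ennreal n * ennreal k \<partial>M)"
    by (simp add: emeasure_space_1)
  also have "\<dots> \<le> (\<integral>\<^sup>+\<omega>. ennreal n * ennreal (?N \<omega>) + ennreal k * S \<omega> \<partial>M)"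
    unfolding S_def by (intro nn_integral_mono visits_return_sum_tradeoff)
  also have "\<dots> = ennreal n * ennreal (\<integral>\<omega>. ?N \<omega> \<partial>M) + ennreal k * (\<integral>\<^sup>+\<omega>. S \<omega> \<partial>M)"
    by (simp add: nn_integral_add nn_integral_cmult nn_integral_visits)
  also have "\<dots> \<le> ennreal n * ennreal (\<integral>\<omega>. ?N \<omega> \<partial>M) + ennreal k * ennreal (real n / 2)"
    using assms(1) unfolding S_def by (intro add_mono mult_left_mono) auto
  also have "\<dots> = ennreal (n * (\<integral>\<omega>. ?N \<omega> \<partial>M) + k * (real n / 2))"
    using EN by (simp add: ennreal_mult[symmetric] ennreal_plus[symmetric] del: ennreal_plus)
  finally have "real n * real k \<le> n * (\<integral>\<omega>. ?N \<omega> \<partial>M) + k * (real n / 2)"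
    using EN by (simp add: ennreal_mult[symmetric] del: ennreal_plus)
  then have "real n * (real k / 2) \<le> n * (\<integral>\<omega>. ?N \<omega> \<partial>M)"
    by (simp add: field_simps)
  then show ?thesis
    using assms(2) by simp
qed

end

theorem proposition4:
  fixes M :: "'w measure"
    and X :: "nat \<Rightarrow> 'w \<Rightarrow> 's::finite"
    and a :: "nat \<Rightarrow> 'w \<Rightarrow> 'a::finite"
    and P :: "'a \<Rightarrow> 's \<Rightarrow> 's \<Rightarrow> real"
    and \<alpha> :: "'s \<Rightarrow> 'a \<Rightarrow> real"
    and T :: "'s \<Rightarrow> 'a \<Rightarrow> nat \<Rightarrow> real"
  assumes "controlled_markov_chain M X a P"
    and "\<And>s l. 0 < \<alpha> s l \<and> \<alpha> s l < 1"
    and "\<And>s l. T s l \<in> O(\<lambda>i. real i powr \<alpha> s l)"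
    and "\<And>s l i. i \<ge> 1 \<Longrightarrow>
      AE \<omega> in M. nn_cond_exp M (return_history M X a s l i)
        (\<lambda>\<omega>. ennreal_of_enat (return_time X a s l i \<omega>)) \<omega> \<le> ennreal (T s l i)"
  shows "\<And>s l. (\<lambda>n. \<integral>\<omega>. visits X a s l n \<omega> \<partial>M) \<in> \<Omega>(\<lambda>n. real n powr (1 / (1 + \<alpha> s l)))"
proof -
  fix s l
  interpret controlled_markov_chain M X a P by fact
  define q where "q = \<alpha> s l"
  have q: "q > 0" using assms(2) by (simp add: q_def)
  obtain C where "C > 0" and C: "\<And>i. i \<ge> 1 \<Longrightarrow> T s l i \<le> C * real i powr q"
    using bigo_powr_uniform_bound[OF assms(3)[of s l]] q unfolding q_def by auto
  have tau: "(\<integral>\<^sup>+\<omega>. ennreal_of_enat (return_time X a s l i \<omega>) \<partial>M) \<le> ennreal (C * real i powr q)"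
    if "i \<ge> 1" for i
    using nn_integral_return_time_le[OF assms(4)[OF that, of s l]] C[OF that]
    by (auto intro: order_trans ennreal_leI)
  define p where "p = 1 / (1 + q)"
  have p: "p > 0" "p * (1 + q) = 1" using q by (auto simp: p_def)
  \<comment> \<open>This c solves C (c n^p)^(1+q) = n/2: since p (1+q) = 1, the power equals n /
    (2C).\<close>
  define c where "c = (1 / (2 * C)) powr p"
  have "c > 0" using \<open>C > 0\<close> by (simp add: c_def)
  \<comment> \<open>Rounding c n^p down to an integer k loses less than 1, which is at most half of
    c n^p once c n^p >= 2. So k/2 >= c n^p / 4, whence the factor c/4.\<close>
  have bound: "c / 4 * real n powr p \<le> (\<integral>\<omega>. visits X a s l n \<omega> \<partial>M)"
    if n: "n > 0" "c * real n powr p \<ge> 2" for n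
  proof -
    define k where "k = nat \<lfloor>c * real n powr p\<rfloor>"
    have k: "real k \<le> c * real n powr p" "c * real n powr p - 1 \<le> real k"
      using n(2) unfolding k_def by linarith+
    have "C * real k powr (1 + q) \<le> C * (c * real n powr p) powr (1 + q)"
      using k(1) q \<open>C > 0\<close> by (intro mult_left_mono powr_mono2) auto
    also have "\<dots> = real n / 2"
      using p(2) \<open>C > 0\<close> n(1) by (simp add: c_def powr_mult powr_powr)
    finally have "(\<integral>\<^sup>+\<omega>. ennreal_of_enat (return_sum X a s l (Suc k) \<omega>) \<partial>M) \<le> ennreal (real n / 2)"
      using nn_integral_return_sum_le[OF tau, of k] \<open>C > 0\<close> q
      by (auto intro: order_trans ennreal_leI)
    from expected_visits_ge[OF this n(1)] show ?thesis
      using k(2) n(2) by (simp add: field_simps)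
  qed
  \<comment> \<open>As c and p are positive, c n^p tends to infinity, so the threshold 2 is
    eventually passed.\<close>
  have "filterlim (\<lambda>n. c * real n powr p) at_top sequentially"
    using \<open>c > 0\<close> p(1)
    by (intro filterlim_tendsto_pos_mult_at_top[OF tendsto_const] filterlim_compose[OF real_powr_at_top]
              filterlim_real_sequentially)
  then have "eventually (\<lambda>n. c * real n powr p \<ge> 2) sequentially"
    by (simp add: filterlim_at_top)
  then have "eventually (\<lambda>n. norm (\<integral>\<omega>. visits X a s l n \<omega> \<partial>M) \<ge> c / 4 * norm (real n powr p))
      sequentially"
    using eventually_gt_at_top[of 0]
  proof eventually_elim
    case (elim n)
    then show ?case
      using bound[of n] by simp
  qed
  then show "(\<lambda>n. \<integral>\<omega>. visits X a s l n \<omega> \<partial>M) \<in> \<Omega>(\<lambda>n. real n powr (1 / (1 + \<alpha> s l)))"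
    using \<open>c > 0\<close> unfolding p_def q_def by (intro landau_omega.bigI[of "c / 4"]) auto
qed

end
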